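(* Let $A$ be a Stein manifold. Let $X\subset A$ be a hyperbolic domain (i.e. the Kobayashi pseudodistance $k_X$ is a distance on $X$) and let $f:X\to X$ be a holomorphic map such that $f(X)$ is relatively compact in $X$. Then $f$ has a unique fixed point $c\in X$, and the sequence of iterates $(f^n)$ converges, for the compact-open topology, to the constant map $z\mapsto c$.
   Context: A domain is a nonempty connected open set. $\Delta\subset\mathbb{C}$ is the open unit disc, and $H(\Delta,X)$ is the set of holomorphic maps $\Delta\to X$. The Kobayashi (Royden–Kobayashi) infinitesimal pseudometric is, for $x\in X$, $v\in T_xX$, $$F_X(x,v)=\inf\{|\lambda| : \lambda\in\mathbb{C},\ \exists\,\varphi\in H(\Delta,X)\text{ with }\varphi(0)=x,\ \lambda\varphi'(0)=v\}.$$ The Kobayashi pseudodistance $k_X(a,b)$ is the infimum, over all piecewise $C^1$ paths $\gamma:[0,1]\to X$ with $\gamma(0)=a$, $\gamma(1)=b$, of the length $\int_0^1F_X(\gamma(t),\gamma'(t))\,dt$. A distance is a pseudodistance that separates points. $f^n$ denotes the $n$-fold composition of $f$ with itself. *)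

theory Defs
  imports "HOL-Analysis.Analysis"
begin

section \<open>Complex manifolds\<close>

text \<open>
  A chart is a coordinate domain with a coordinate map. A coordinate map takes values in a
  relatively open subset of some complex linear subspace of \<open>complex ^ 'n\<close>, which may depend on
  the chart. So the type \<open>'n\<close> only bounds the dimension of a manifold from above: every dimension
  from 0 to \<open>CARD('n)\<close> occurs, and different connected components may have different dimensions.
\<close>

type_synonym ('a, 'n) chart = "'a set \<times> ('a \<Rightarrow> complex ^ 'n)"

definition chart :: "'a topology \<Rightarrow> ('a, 'n::finite) chart \<Rightarrow> bool" where
  "chart T c \<longleftrightarrow> (case c of (U, h) \<Rightarrow>
     openin T U \<and>
     (\<exists>E. vec.subspace E \<and> openin (top_of_set E) (h ` U)) \<and>
     homeomorphic_map (subtopology T U) (top_of_set (h ` U)) h)"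

text \<open>
  Holomorphy in several variables: Frechet differentiability with a complex linear derivative.
  This is used only for sets \<open>S\<close> that are relatively open in a complex subspace \<open>E\<close>. The
  derivative within \<open>S\<close> is then the derivative along \<open>E\<close>, and only the restriction of \<open>L\<close> to \<open>E\<close>
  matters.
\<close>

definition mv_holomorphic_on :: "(complex ^ 'n::finite \<Rightarrow> complex) \<Rightarrow> (complex ^ 'n) set \<Rightarrow> bool" where
  "mv_holomorphic_on g S \<longleftrightarrow>
     (\<forall>z\<in>S. \<exists>L. (g has_derivative L) (at z within S) \<and> (\<forall>a v. L (a *s v) = a * L v))"

definition complex_manifold :: "'a topology \<Rightarrow> ('a, 'n::finite) chart set \<Rightarrow> bool" where
  "complex_manifold T \<A> \<longleftrightarrow>
     Hausdorff_space T \<and> second_countable T \<and>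
     (\<forall>c\<in>\<A>. chart T c) \<and> topspace T = (\<Union>c\<in>\<A>. fst c) \<and>
     (\<forall>(U, h)\<in>\<A>. \<forall>(V, k)\<in>\<A>. \<forall>i.
        mv_holomorphic_on (\<lambda>z. k (inv_into U h z) $ i) (h ` (U \<inter> V)))"

definition holomorphic_function ::
    "'a topology \<Rightarrow> ('a, 'n::finite) chart set \<Rightarrow> ('a \<Rightarrow> complex) \<Rightarrow> bool" where
  "holomorphic_function T \<A> g \<longleftrightarrow>
     continuous_map T euclidean g \<and>
     (\<forall>(U, h)\<in>\<A>. mv_holomorphic_on (\<lambda>z. g (inv_into U h z)) (h ` U))"

text \<open>Holomorphic maps between open subsets \<open>X\<close> and \<open>Y\<close> of the same manifold.\<close>

definition holomorphic_map ::
    "'a topology \<Rightarrow> ('a, 'n::finite) chart set \<Rightarrow> 'a set \<Rightarrow> 'a set \<Rightarrow> ('a \<Rightarrow> 'a) \<Rightarrow> bool" where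
  "holomorphic_map T \<A> X Y f \<longleftrightarrow>
     continuous_map (subtopology T X) (subtopology T Y) f \<and>
     (\<forall>(U, h)\<in>\<A>. \<forall>(V, k)\<in>\<A>. \<forall>i.
        mv_holomorphic_on (\<lambda>z. k (f (inv_into U h z)) $ i) (h ` {x \<in> U \<inter> X. f x \<in> V}))"

section \<open>Stein manifolds\<close>

definition holomorphic_hull ::
    "'a topology \<Rightarrow> ('a, 'n::finite) chart set \<Rightarrow> 'a set \<Rightarrow> 'a set" where
  "holomorphic_hull T \<A> K =
     {x \<in> topspace T. \<forall>g. holomorphic_function T \<A> g \<longrightarrow>
        ennreal (cmod (g x)) \<le> (SUP y\<in>K. ennreal (cmod (g y)))}"

text \<open>
  Holomorphically convex and holomorphically separable. By Grauert's theorem, the existence of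
  local coordinates given by global holomorphic functions, which some authors also require, follows.
\<close>

definition stein_manifold :: "'a topology \<Rightarrow> ('a, 'n::finite) chart set \<Rightarrow> bool" where
  "stein_manifold T \<A> \<longleftrightarrow>
     complex_manifold T \<A> \<and>
     (\<forall>K. compactin T K \<longrightarrow> compactin T (holomorphic_hull T \<A> K)) \<and>
     (\<forall>x\<in>topspace T. \<forall>y\<in>topspace T. x \<noteq> y \<longrightarrow>
        (\<exists>g. holomorphic_function T \<A> g \<and> g x \<noteq> g y))"

section \<open>The Kobayashi pseudometric and pseudodistance\<close>

definition domain_in :: "'a topology \<Rightarrow> 'a set \<Rightarrow> bool" where
  "domain_in T X \<longleftrightarrow> X \<noteq> {} \<and> openin T X \<and> connectedin T X"

definition holomorphic_disc ::
    "'a topology \<Rightarrow> ('a, 'n::finite) chart set \<Rightarrow> 'a set \<Rightarrow> (complex \<Rightarrow> 'a) \<Rightarrow> bool" where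
  "holomorphic_disc T \<A> X \<phi> \<longleftrightarrow>
     continuous_map (top_of_set (ball 0 1)) (subtopology T X) \<phi> \<and>
     (\<forall>(U, h)\<in>\<A>. \<forall>i. (\<lambda>\<zeta>. h (\<phi> \<zeta>) $ i) holomorphic_on {\<zeta> \<in> ball 0 1. \<phi> \<zeta> \<in> U})"

text \<open>
  A tangent vector at \<open>x\<close> is represented by the family of its coordinate vectors, indexed by the
  charts. Values at charts whose domain does not contain \<open>x\<close> are irrelevant.
\<close>

type_synonym ('a, 'n) tangent = "('a, 'n) chart \<Rightarrow> complex ^ 'n"

definition disc_derivative :: "(complex \<Rightarrow> 'a) \<Rightarrow> complex \<Rightarrow> ('a, 'n::finite) tangent" where
  "disc_derivative \<phi> \<zeta> = (\<lambda>(U, h). \<chi> i. deriv (\<lambda>w. h (\<phi> w) $ i) \<zeta>)"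

definition path_derivative :: "(real \<Rightarrow> 'a) \<Rightarrow> real \<Rightarrow> ('a, 'n::finite) tangent" where
  "path_derivative \<gamma> t = (\<lambda>(U, h). vector_derivative (\<lambda>s. h (\<gamma> s)) (at t))"

definition kobayashi_metric ::
    "'a topology \<Rightarrow> ('a, 'n::finite) chart set \<Rightarrow> 'a set \<Rightarrow> 'a \<Rightarrow> ('a, 'n) tangent \<Rightarrow> ennreal" where
  "kobayashi_metric T \<A> X x v =
     Inf {ennreal (cmod l) | l. \<exists>\<phi>. holomorphic_disc T \<A> X \<phi> \<and> \<phi> 0 = x \<and>
            (\<forall>c\<in>\<A>. x \<in> fst c \<longrightarrow> l *s disc_derivative \<phi> 0 c = v c)}"

definition C1_path_on ::
    "('a, 'n::finite) chart set \<Rightarrow> (real \<Rightarrow> 'a) \<Rightarrow> real \<Rightarrow> real \<Rightarrow> bool" where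
  "C1_path_on \<A> \<gamma> a b \<longleftrightarrow>
     (\<forall>(U, h)\<in>\<A>. \<exists>D. continuous_on {t \<in> {a..b}. \<gamma> t \<in> U} D \<and>
        (\<forall>t\<in>{t \<in> {a..b}. \<gamma> t \<in> U}.
           ((\<lambda>s. h (\<gamma> s)) has_vector_derivative D t) (at t within {t \<in> {a..b}. \<gamma> t \<in> U})))"

text \<open>
  Being \<open>C\<^sup>1\<close> is required on the closed intervals between consecutive break points, with one-sided
  derivatives at the ends. This is more than \<open>piecewise_C1_differentiable_on\<close> asks for.
\<close>

definition piecewise_C1_path ::
    "'a topology \<Rightarrow> ('a, 'n::finite) chart set \<Rightarrow> 'a set \<Rightarrow> (real \<Rightarrow> 'a) \<Rightarrow> bool" where
  "piecewise_C1_path T \<A> X \<gamma> \<longleftrightarrow>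
     continuous_map (top_of_set {0..1}) (subtopology T X) \<gamma> \<and>
     (\<exists>S. finite S \<and>
        (\<forall>a b. 0 \<le> a \<and> a < b \<and> b \<le> 1 \<and> {a<..<b} \<inter> S = {} \<longrightarrow> C1_path_on \<A> \<gamma> a b))"

definition kobayashi_length ::
    "'a topology \<Rightarrow> ('a, 'n::finite) chart set \<Rightarrow> 'a set \<Rightarrow> (real \<Rightarrow> 'a) \<Rightarrow> ennreal" where
  "kobayashi_length T \<A> X \<gamma> =
     (\<integral>\<^sup>+t\<in>{0..1}. kobayashi_metric T \<A> X (\<gamma> t) (path_derivative \<gamma> t) \<partial>lborel)"

definition kobayashi_dist ::
    "'a topology \<Rightarrow> ('a, 'n::finite) chart set \<Rightarrow> 'a set \<Rightarrow> 'a \<Rightarrow> 'a \<Rightarrow> ennreal" where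
  "kobayashi_dist T \<A> X a b =
     Inf {kobayashi_length T \<A> X \<gamma> | \<gamma>. piecewise_C1_path T \<A> X \<gamma> \<and> \<gamma> 0 = a \<and> \<gamma> 1 = b}"

definition hyperbolic_domain :: "'a topology \<Rightarrow> ('a, 'n::finite) chart set \<Rightarrow> 'a set \<Rightarrow> bool" where
  "hyperbolic_domain T \<A> X \<longleftrightarrow>
     domain_in T X \<and> (\<forall>a\<in>X. \<forall>b\<in>X. kobayashi_dist T \<A> X a b = 0 \<longrightarrow> a = b)"

section \<open>Relative compactness and the compact-open topology\<close>

definition relatively_compact_in :: "'a topology \<Rightarrow> 'a set \<Rightarrow> bool" where
  "relatively_compact_in X S \<longleftrightarrow> S \<subseteq> topspace X \<and> compactin X (X closure_of S)"

text \<open>The points are the continuous maps, as total functions without a convention off \<open>topspace X\<close>.\<close>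

definition compact_open_topology :: "'a topology \<Rightarrow> 'b topology \<Rightarrow> ('a \<Rightarrow> 'b) topology" where
  "compact_open_topology X Y =
     topology_generated_by
       {{g. continuous_map X Y g \<and> g ` K \<subseteq> U} | K U. compactin X K \<and> openin Y U}"

end

theory Submission
  imports Defs "HOL-Complex_Analysis.Conformal_Mappings"
begin

text \<open>
  Let \<open>K\<close> be the closure of \<open>f(X)\<close>, a compact subset of the connected manifold \<open>X\<close>. By Harnack's
  inequality there is a constant \<open>q < 1\<close> such that every holomorphic \<open>u\<close> on \<open>X\<close> with \<open>Re u\<close> bounded
  satisfies \<open>osc\<^sub>K (Re u) \<le> q osc\<^sub>X (Re u)\<close>. Since \<open>f(X) \<subseteq> K\<close>, iterating gives
  \<open>osc\<^sub>X (Re (g \<circ> f\<^sup>n)) \<rightarrow> 0\<close> for every holomorphic function \<open>g\<close> on \<open>A\<close>, so that \<open>g\<close> is constant on the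
  intersection of the decreasing compact sets \<open>f\<^sup>n(K)\<close>. Holomorphic functions separate the points of
  \<open>A\<close>; hence this intersection is a single point, which is the fixed point, and the sets \<open>f\<^sup>n(X)\<close>
  shrink to it.
\<close>

section \<open>Harnack's inequality in the disc\<close>

text \<open>The Moebius map taking the right half-plane to the disc and \<open>F 0\<close> to
  \<open>0\<close> turns \<open>F\<close> into a map \<open>G\<close> to which the Schwarz lemma
  applies. For \<open>cmod \<zeta> \<le> 1/2\<close> this gives the factor 3 = (1 + 1/2) / (1 -
  1/2), in both directions.\<close>

lemma Harnack_disc_pos:
  assumes holF: "F holomorphic_on ball 0 1"
    and pos: "\<And>z. z \<in> ball 0 1 \<Longrightarrow> Re (F z) > 0"
    and \<zeta>: "cmod \<zeta> \<le> 1/2"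
  shows "Re (F \<zeta>) \<le> 3 * Re (F 0)" "Re (F 0) \<le> 3 * Re (F \<zeta>)"
proof -
  define G where "G = (\<lambda>z. (F z - F 0) / (F z + cnj (F 0)))"
  have p0: "Re (F 0) > 0" using pos by simp
  have nz: "F z + cnj (F 0) \<noteq> 0" if "z \<in> ball 0 1" for z
  proof
    assume "F z + cnj (F 0) = 0"
    then have "Re (F z) + Re (F 0) = 0"
      by (metis complex_cnj(1) plus_complex.simps(1) zero_complex.simps(1) complex.collapse complex.sel(1))
    with pos[OF that] p0 show False by linarith
  qed
  have less: "cmod (F z - F 0) < cmod (F z + cnj (F 0))" if "z \<in> ball 0 1" for z
  proof -
    \<comment> \<open>The two squared moduli compared below differ by exactly
      \<open>4 * Re (F z) * Re (F 0)\<close>.\<close>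
    have "Re (F z) * Re (F 0) > 0" using pos[OF that] p0 by simp
    then have "(cmod (F z - F 0))\<^sup>2 < (cmod (F z + cnj (F 0)))\<^sup>2"
      unfolding cmod_power2 by (simp add: power2_eq_square algebra_simps)
    then show ?thesis by (rule power_less_imp_less_base) simp
  qed
  have "G holomorphic_on ball 0 1"
    unfolding G_def by (intro holomorphic_intros holF nz)
  moreover have "G 0 = 0" by (simp add: G_def)
  moreover have "cmod (G z) < 1" if "cmod z < 1" for z
    using less[of z] nz[of z] that by (simp add: G_def norm_divide divide_simps)
  ultimately have "cmod (G \<zeta>) \<le> cmod \<zeta>"
    using \<zeta> by (intro Schwarz_Lemma(1)) auto
  with \<zeta> have "cmod (G \<zeta>) \<le> 1/2" by linarith
  moreover have "\<zeta> \<in> ball 0 1" using \<zeta> by simp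
  ultimately have half: "2 * cmod (F \<zeta> - F 0) \<le> cmod (F \<zeta> + cnj (F 0))"
    using nz[of \<zeta>] by (simp add: G_def norm_divide divide_simps split: if_splits)
  have Re_le: "\<bar>Re (F \<zeta>) - Re (F 0)\<bar> \<le> cmod (F \<zeta> - F 0)"
    using abs_Re_le_cmod[of "F \<zeta> - F 0"] by simp
  \<comment> \<open>The denominator of \<open>G\<close> is compared with \<open>2 * Re (F 0)\<close>
    for the first inequality and with \<open>2 * Re (F \<zeta>)\<close> for the second; either way
    \<open>cmod (F \<zeta> - F 0)\<close> is at most that number.\<close>
  have "F \<zeta> + cnj (F 0) = (F \<zeta> - F 0) + of_real (2 * Re (F 0))"
    by (simp add: complex_eq_iff)
  then have "cmod (F \<zeta> + cnj (F 0)) \<le> cmod (F \<zeta> - F 0) + \<bar>2 * Re (F 0)\<bar>"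
    by (metis norm_of_real norm_triangle_ineq)
  with half Re_le show "Re (F \<zeta>) \<le> 3 * Re (F 0)" using p0 by linarith
  have "Re (F \<zeta>) > 0" using pos[of \<zeta>] \<zeta> by simp
  have "F \<zeta> + cnj (F 0) = of_real (2 * Re (F \<zeta>)) - cnj (F \<zeta> - F 0)"
    by (simp add: complex_eq_iff)
  then have "cmod (F \<zeta> + cnj (F 0)) \<le> \<bar>2 * Re (F \<zeta>)\<bar> + cmod (F \<zeta> - F 0)"
    by (metis complex_mod_cnj norm_of_real norm_triangle_ineq4)
  with half Re_le show "Re (F 0) \<le> 3 * Re (F \<zeta>)"
    using \<open>Re (F \<zeta>) > 0\<close> by linarith
qed

text \<open>Adding \<open>e > 0\<close> to \<open>F\<close> makes the real part strictly positive;
  then \<open>e\<close> tends to 0.\<close>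

lemma Harnack_disc:
  assumes holF: "F holomorphic_on ball 0 1"
    and nonneg: "\<And>z. z \<in> ball 0 1 \<Longrightarrow> Re (F z) \<ge> 0"
    and \<zeta>: "cmod \<zeta> \<le> 1/2"
  shows "Re (F \<zeta>) \<le> 3 * Re (F 0)" "Re (F 0) \<le> 3 * Re (F \<zeta>)"
proof -
  have *: "Re (F \<zeta>) \<le> 3 * Re (F 0) + 2 * e" "Re (F 0) \<le> 3 * Re (F \<zeta>) + 2 * e" if "e > 0" for e :: real
  proof -
    have "(\<lambda>z. F z + of_real e) holomorphic_on ball 0 1"
      by (intro holomorphic_intros holF)
    moreover have "Re (F z + of_real e) > 0" if "z \<in> ball 0 1" for z
      using nonneg[OF that] \<open>e > 0\<close> by simp
    ultimately show "Re (F \<zeta>) \<le> 3 * Re (F 0) + 2 * e" "Re (F 0) \<le> 3 * Re (F \<zeta>) + 2 * e"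
      using Harnack_disc_pos[of "\<lambda>z. F z + of_real e" \<zeta>] \<zeta> by fastforce+
  qed
  show "Re (F \<zeta>) \<le> 3 * Re (F 0)"
    by (rule field_le_epsilon) (use *(1)[of "e/2" for e] in simp)
  show "Re (F 0) \<le> 3 * Re (F \<zeta>)"
    by (rule field_le_epsilon) (use *(2)[of "e/2" for e] in simp)
qed

section \<open>Holomorphic functions on an open subset of a manifold\<close>

text \<open>Holomorphy is localised to \<open>X\<close> because a global function composed with
  iterates of \<open>f\<close> is controlled only on \<open>X\<close>, the set that \<open>f\<close>
  maps to itself.\<close>

definition holomorphic_function_on ::
    "('a, 'n::finite) chart set \<Rightarrow> 'a set \<Rightarrow> ('a \<Rightarrow> complex) \<Rightarrow> bool" where
  "holomorphic_function_on \<A> X u \<longleftrightarrow>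
     (\<forall>(U, h)\<in>\<A>. mv_holomorphic_on (\<lambda>z. u (inv_into U h z)) (h ` (U \<inter> X)))"

lemma holomorphic_function_onD:
  assumes "holomorphic_function_on \<A> X u" "(U, h) \<in> \<A>" "z \<in> h ` (U \<inter> X)"
  shows "\<exists>L. ((\<lambda>z. u (inv_into U h z)) has_derivative L) (at z within h ` (U \<inter> X)) \<and>
    (\<forall>a v. L (a *s v) = a * L v)"
proof -
  have "mv_holomorphic_on (\<lambda>z. u (inv_into U h z)) (h ` (U \<inter> X))"
    using assms(1,2) by (auto simp: holomorphic_function_on_def)
  then show ?thesis
    using assms(3) unfolding mv_holomorphic_on_def by (rule bspec)
qed

lemma holomorphic_function_imp_on:
  assumes "holomorphic_function T \<A> g"
  shows "holomorphic_function_on \<A> X g"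
  unfolding holomorphic_function_on_def
proof clarify
  fix U h assume "(U, h) \<in> \<A>"
  then have "mv_holomorphic_on (\<lambda>z. g (inv_into U h z)) (h ` U)"
    using assms by (auto simp: holomorphic_function_def)
  moreover have "h ` (U \<inter> X) \<subseteq> h ` U" by blast
  ultimately show "mv_holomorphic_on (\<lambda>z. g (inv_into U h z)) (h ` (U \<inter> X))"
    unfolding mv_holomorphic_on_def by (meson has_derivative_subset subsetD)
qed

text \<open>Needed for the nonnegative functions \<open>M - u\<close> and \<open>u - m\<close> in
  the oscillation estimate, and for \<open>b * g\<close>, which gives access to the imaginary part
  of \<open>g\<close>.\<close>

lemma holomorphic_function_on_affine:
  assumes "holomorphic_function_on \<A> X u"
  shows "holomorphic_function_on \<A> X (\<lambda>x. a + b * u x)"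
  unfolding holomorphic_function_on_def mv_holomorphic_on_def
proof clarify
  fix U h x assume Uh: "(U, h) \<in> \<A>" and x: "x \<in> U" "x \<in> X"
  then have "h x \<in> h ` (U \<inter> X)" by blast
  from holomorphic_function_onD[OF assms Uh this] obtain L where
    L: "((\<lambda>z. u (inv_into U h z)) has_derivative L) (at (h x) within h ` (U \<inter> X))"
      "\<forall>a v. L (a *s v) = a * L v"
    by blast
  have "((\<lambda>z. a + b * u (inv_into U h z)) has_derivative (\<lambda>v. b * L v))
      (at (h x) within h ` (U \<inter> X))"
    by (auto intro!: derivative_eq_intros L(1))
  moreover have "\<forall>a v. b * L (a *s v) = a * (b * L v)"
    using L(2) by simp
  ultimately show "\<exists>M. ((\<lambda>z. a + b * u (inv_into U h z)) has_derivative M)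
      (at (h x) within h ` (U \<inter> X)) \<and> (\<forall>a v. M (a *s v) = a * M v)"
    by blast
qed

text \<open>Holomorphy of maps is stated componentwise, whereas the chain rule needs one derivative
  of the vector-valued map. Difference quotients converge componentwise.\<close>

lemma has_derivative_vec_lambda:
  fixes g :: "'a::euclidean_space \<Rightarrow> 'b::euclidean_space ^ 'n"
  assumes "\<And>i. ((\<lambda>z. g z $ i) has_derivative L i) (at x within S)"
  shows "(g has_derivative (\<lambda>v. \<chi> i. L i v)) (at x within S)"
proof -
  have lin: "linear (L i)" for i
    using assms has_derivative_linear by blast
  have "linear (\<lambda>v. \<chi> i. L i v)"
    by (rule linearI) (simp_all add: vec_eq_iff linear_add[OF lin] linear_scale[OF lin])
  then have "bounded_linear (\<lambda>v. \<chi> i. L i v)"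
    by (simp add: linear_conv_bounded_linear)
  moreover have "((\<lambda>y. (1 / norm (y - x)) *\<^sub>R (g y - (g x + (\<chi> i. L i (y - x))))) \<longlongrightarrow> 0) (at x within S)"
    by (rule vec_tendstoI) (use assms in \<open>simp add: has_derivative_within\<close>)
  ultimately show ?thesis
    by (simp add: has_derivative_within)
qed

lemma at_within_openin:
  assumes "openin (top_of_set S) T" "x \<in> T"
  shows "at x within S = at x within T"
proof -
  obtain V where V: "open V" "T = S \<inter> V"
    using assms(1) by (auto simp: openin_open)
  with assms(2) show ?thesis
    by (intro at_within_nhd[of x V]) auto
qed

lemma chart_image_openin:
  assumes "chart T (U, h)" "openin T W"
  shows "openin (top_of_set (h ` U)) (h ` (U \<inter> W))"
proof -
  have "openin (subtopology T U) (U \<inter> W)"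
    using assms(2) by (simp add: openin_subtopology_Int2)
  then show ?thesis
    using assms(1) homeomorphic_map_openness_eq by (fastforce simp: chart_def)
qed

lemma chart_inj_on:
  assumes "chart T (U, h)"
  shows "inj_on h U"
proof -
  have "openin T U" "homeomorphic_map (subtopology T U) (top_of_set (h ` U)) h"
    using assms by (auto simp: chart_def)
  then show ?thesis
    using homeomorphic_imp_injective_map openin_subset topspace_subtopology_subset by metis
qed

text \<open>This is the chain rule in charts. Holomorphy of \<open>f\<close> is given on the part
  \<open>W\<close> of \<open>U \<inter> X\<close> sent into one target chart. Continuity of
  \<open>f\<close> makes \<open>h\<close> W\<open>relatively open in\<close>h
  \<open>(U \<inter> X)\<close>, so derivatives within the two sets agree.\<close>

lemma holomorphic_function_on_compose:
  fixes \<A> :: "('a, 'n::finite) chart set"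
  assumes man: "complex_manifold T \<A>" and X: "openin T X"
    and f: "holomorphic_map T \<A> X X f" and u: "holomorphic_function_on \<A> X u"
  shows "holomorphic_function_on \<A> X (\<lambda>x. u (f x))"
  unfolding holomorphic_function_on_def mv_holomorphic_on_def
proof clarify
  fix U h x assume Uh: "(U, h) \<in> \<A>" and x: "x \<in> U" "x \<in> X"
  have cf: "continuous_map (subtopology T X) (subtopology T X) f"
    using f by (simp add: holomorphic_map_def)
  have tX: "topspace (subtopology T X) = X"
    using openin_subset X by (intro topspace_subtopology_subset) blast
  have fX: "f y \<in> X" if "y \<in> X" for y
    using continuous_map_funspace[OF cf] that unfolding tX by blast
  then have fx: "f x \<in> X" using x by blast
  then have "f x \<in> topspace T" using openin_subset[OF X] by blast
  then obtain V k where Vk: "(V, k) \<in> \<A>" "f x \<in> V"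
    using man by (force simp: complex_manifold_def)
  have chU: "chart T (U, h)" and chV: "chart T (V, k)"
    using man Uh Vk by (auto simp: complex_manifold_def)
  note injU = chart_inj_on[OF chU] and injV = chart_inj_on[OF chV]
  define W where "W = {y \<in> U \<inter> X. f y \<in> V}"
  have "openin (subtopology T X) (V \<inter> X)"
    using chV by (simp add: chart_def openin_subtopology_Int)
  then have "openin (subtopology T X) {y \<in> topspace (subtopology T X). f y \<in> V \<inter> X}"
    using cf openin_continuous_map_preimage by blast
  moreover have "{y \<in> topspace (subtopology T X). f y \<in> V \<inter> X} = {y \<in> X. f y \<in> V}"
    using fX unfolding tX by blast
  ultimately have "openin T {y \<in> X. f y \<in> V}"
    using X by (simp add: openin_trans_full)
  moreover have W_eq: "W = U \<inter> {y \<in> X. f y \<in> V}" by (auto simp: W_def)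
  ultimately have "openin (top_of_set (h ` U)) (h ` W)"
    using chart_image_openin[OF chU] by simp
  moreover have "h ` W \<subseteq> h ` (U \<inter> X)" "h ` (U \<inter> X) \<subseteq> h ` U" by (auto simp: W_def)
  ultimately have "openin (top_of_set (h ` (U \<inter> X))) (h ` W)"
    by (rule openin_subset_trans)
  moreover have xW: "h x \<in> h ` W" using x Vk by (auto simp: W_def)
  ultimately have at_eq: "at (h x) within h ` (U \<inter> X) = at (h x) within h ` W"
    by (rule at_within_openin)
  define G where "G = (\<lambda>z. k (f (inv_into U h z)))"
  have inv: "inv_into U h (h y) = y" if "y \<in> W" for y
    using that injU by (simp add: W_def)
  have "mv_holomorphic_on (\<lambda>z. G z $ i) (h ` W)" for i
    using bspec[OF bspec[OF conjunct2[OF f[unfolded holomorphic_map_def]] Uh, unfolded prod.case]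
        Vk(1), unfolded prod.case] by (simp only: G_def W_def)
  then have "\<exists>L. ((\<lambda>z. G z $ i) has_derivative L) (at (h x) within h ` W) \<and> (\<forall>a v. L (a *s v) = a * L v)"
    for i
    using xW unfolding mv_holomorphic_on_def by (rule bspec)
  then obtain L where L: "\<And>i. ((\<lambda>z. G z $ i) has_derivative L i) (at (h x) within h ` W)"
    "\<And>i a v. L i (a *s v) = a * L i v"
    by metis
  have G: "(G has_derivative (\<lambda>v. \<chi> i. L i v)) (at (h x) within h ` W)"
    by (rule has_derivative_vec_lambda) (rule L)
  have Gx: "G (h x) = k (f x)" using inv x Vk by (simp add: G_def W_def)
  have "k (f x) \<in> k ` (V \<inter> X)" using Vk fx by blast
  then obtain M where M: "((\<lambda>z. u (inv_into V k z)) has_derivative M) (at (k (f x)) within k ` (V \<inter> X))"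
    "\<forall>a v. M (a *s v) = a * M v"
    using holomorphic_function_onD[OF u Vk(1)] by blast
  have "G ` h ` W \<subseteq> k ` (V \<inter> X)"
    using fX inv by (auto simp: G_def W_def)
  with M(1) have "((\<lambda>z. u (inv_into V k z)) has_derivative M) (at (G (h x)) within G ` h ` W)"
    unfolding Gx by (rule has_derivative_subset)
  then have "((\<lambda>z. u (inv_into V k z)) \<circ> G has_derivative M \<circ> (\<lambda>v. \<chi> i. L i v)) (at (h x) within h ` W)"
    by (rule diff_chain_within[OF G])
  then have "((\<lambda>z. u (f (inv_into U h z))) has_derivative M \<circ> (\<lambda>v. \<chi> i. L i v)) (at (h x) within h ` W)"
    by (rule has_derivative_transform[OF xW, rotated])
      (use inv injV in \<open>auto simp: G_def W_def\<close>)
  moreover have "(M \<circ> (\<lambda>v. \<chi> i. L i v)) (a *s v) = a * (M \<circ> (\<lambda>v. \<chi> i. L i v)) v" for a v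
  proof -
    have "(\<chi> i. L i (a *s v)) = a *s (\<chi> i. L i v)"
      using L(2) by (simp add: vec_eq_iff)
    then show ?thesis using M(2) by simp
  qed
  ultimately show "\<exists>N. ((\<lambda>z. u (f (inv_into U h z))) has_derivative N)
      (at (h x) within h ` (U \<inter> X)) \<and> (\<forall>a v. N (a *s v) = a * N v)"
    unfolding at_eq by blast
qed

section \<open>Harnack's inequality on a manifold\<close>

lemma norm_vector_scalar_mult: "norm (c *s v) = cmod c * norm v" for v :: "complex ^ 'n::finite"
  by (simp add: norm_vec_def norm_mult L2_set_right_distrib)

text \<open>The constant is uniform in \<open>u\<close>, and the order of the points matters: the
  value at \<open>p\<close> is bounded by the value at \<open>q\<close>. Constants multiply along
  chains of points.\<close>

definition Harnack_constant ::
    "('a, 'n::finite) chart set \<Rightarrow> 'a set \<Rightarrow> 'a \<Rightarrow> 'a \<Rightarrow> real \<Rightarrow> bool" where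
  "Harnack_constant \<A> X p q C \<longleftrightarrow>
     (\<forall>u. holomorphic_function_on \<A> X u \<and> (\<forall>x\<in>X. Re (u x) \<ge> 0) \<longrightarrow> Re (u p) \<le> C * Re (u q))"

lemma Harnack_constant_trans:
  assumes "Harnack_constant \<A> X p q C" "Harnack_constant \<A> X q r D" "C \<ge> 0"
  shows "Harnack_constant \<A> X p r (C * D)"
  unfolding Harnack_constant_def
proof clarify
  fix u assume u: "holomorphic_function_on \<A> X u" "\<forall>x\<in>X. Re (u x) \<ge> 0"
  then have "Re (u p) \<le> C * Re (u q)" "Re (u q) \<le> D * Re (u r)"
    using assms by (auto simp: Harnack_constant_def)
  then show "Re (u p) \<le> C * D * Re (u r)"
    using mult_left_mono[of "Re (u q)" "D * Re (u r)" C] \<open>C \<ge> 0\<close> by (simp add: mult.assoc)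
qed

text \<open>Near \<open>h p\<close> the chart image contains a ball of the subspace
  \<open>E\<close>. A point \<open>q\<close> in the ball of half the radius lies on an affine
  complex disc centred at \<open>h p\<close> inside that image, and the inequality in the disc gives
  the constant 3.\<close>

lemma Harnack_local:
  fixes \<A> :: "('a, 'n::finite) chart set"
  assumes man: "complex_manifold T \<A>" and X: "openin T X" and p: "p \<in> X"
  obtains N where "openin T N" "p \<in> N" "N \<subseteq> X"
    "\<And>q. q \<in> N \<Longrightarrow> Harnack_constant \<A> X p q 3 \<and> Harnack_constant \<A> X q p 3"
proof -
  have "p \<in> topspace T" using p openin_subset[OF X] by blast
  then obtain U h where Uh: "(U, h) \<in> \<A>" "p \<in> U"
    using man by (force simp: complex_manifold_def)
  have ch: "chart T (U, h)" using man Uh by (auto simp: complex_manifold_def)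
  note inj = chart_inj_on[OF ch]
  obtain E where E: "vec.subspace E" "openin (top_of_set E) (h ` U)"
    and opU: "openin T U" and hom: "homeomorphic_map (subtopology T U) (top_of_set (h ` U)) h"
    using ch by (auto simp: chart_def)
  have "openin (top_of_set E) (h ` (U \<inter> X))"
    using chart_image_openin[OF ch X] E(2) openin_trans by blast
  moreover have "h p \<in> h ` (U \<inter> X)" using Uh p by blast
  ultimately obtain r where r: "r > 0" "ball (h p) r \<inter> E \<subseteq> h ` (U \<inter> X)"
    by (meson openin_contains_ball)
  have hE: "h x \<in> E" if "x \<in> U" for x
    using that E(2) openin_imp_subset by blast
  define N where "N = {x \<in> U. h x \<in> ball (h p) (r/2)} \<inter> X"
  have "continuous_map (subtopology T U) euclidean h"
    using homeomorphic_imp_continuous_map[OF hom] by (rule continuous_map_into_fulltopology)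
  then have "openin (subtopology T U) {x \<in> topspace (subtopology T U). h x \<in> ball (h p) (r/2)}"
    by (rule openin_continuous_map_preimage) simp
  moreover have "topspace (subtopology T U) = U"
    using openin_subset[OF opU] by (rule topspace_subtopology_subset)
  ultimately have "openin (subtopology T U) {x \<in> U. h x \<in> ball (h p) (r/2)}"
    by (simp only:)
  then have "openin T {x \<in> U. h x \<in> ball (h p) (r/2)}"
    using opU by (rule openin_trans_full)
  then have "openin T N" using X by (simp add: N_def openin_Int)
  moreover have "p \<in> N" using Uh p r by (simp add: N_def)
  moreover have "N \<subseteq> X" by (simp add: N_def)
  moreover have "Harnack_constant \<A> X p q 3 \<and> Harnack_constant \<A> X q p 3" if "q \<in> N" for q
  proof -
    \<comment> \<open>The factor 2 puts \<open>h q\<close> at the parameter 1/2, and the half radius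
      gives \<open>norm w < r\<close>, which keeps the whole unit disc inside the ball.\<close>
    define w where "w = 2 *s (h q - h p)"
    define \<phi> where "\<phi> = (\<lambda>\<zeta>::complex. h p + \<zeta> *s w)"
    have q: "q \<in> U" "dist (h p) (h q) < r/2" using that by (auto simp: N_def)
    have "norm w = 2 * dist (h p) (h q)"
      unfolding w_def norm_vector_scalar_mult dist_norm by (simp add: norm_minus_commute)
    with q have "norm w < r" by simp
    have \<phi>_in: "\<phi> \<zeta> \<in> h ` (U \<inter> X)" if "\<zeta> \<in> ball 0 1" for \<zeta>
    proof -
      have "cmod \<zeta> * norm w \<le> 1 * norm w"
        using that by (intro mult_right_mono) auto
      then have "\<phi> \<zeta> \<in> ball (h p) r"
        using \<open>norm w < r\<close> by (simp add: \<phi>_def dist_norm norm_vector_scalar_mult)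
      moreover have "\<phi> \<zeta> \<in> E"
        unfolding \<phi>_def w_def
        by (intro vec.subspace_add[OF E(1)] vec.subspace_scale[OF E(1)] vec.subspace_diff[OF E(1)] hE q Uh)
      ultimately show ?thesis using r by blast
    qed
    have \<phi>0: "inv_into U h (\<phi> 0) = p"
      using inj Uh by (simp add: \<phi>_def)
    have "\<phi> (1/2) = h q"
      by (simp add: \<phi>_def w_def vec_eq_iff)
    then have \<phi>q: "inv_into U h (\<phi> (1/2)) = q"
      using inj q by simp
    have *: "Re (u q) \<le> 3 * Re (u p) \<and> Re (u p) \<le> 3 * Re (u q)"
      if u: "holomorphic_function_on \<A> X u" "\<forall>x\<in>X. Re (u x) \<ge> 0" for u
    proof -
      define F where "F = (\<lambda>\<zeta>. u (inv_into U h (\<phi> \<zeta>)))"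
      have "F holomorphic_on ball 0 1"
        unfolding holomorphic_on_def
      proof
        fix \<zeta> :: complex assume \<zeta>: "\<zeta> \<in> ball 0 1"
        obtain L where L: "((\<lambda>z. u (inv_into U h z)) has_derivative L) (at (\<phi> \<zeta>) within h ` (U \<inter> X))"
          "\<forall>a v. L (a *s v) = a * L v"
          using holomorphic_function_onD[OF u(1) Uh(1) \<phi>_in[OF \<zeta>]] by blast
        have \<phi>': "(\<phi> has_derivative (\<lambda>v. \<chi> i. v * w $ i)) (at \<zeta> within ball 0 1)"
          by (rule has_derivative_vec_lambda) (auto simp: \<phi>_def intro!: derivative_eq_intros)
        have "((\<lambda>z. u (inv_into U h z)) has_derivative L) (at (\<phi> \<zeta>) within \<phi> ` ball 0 1)"
          using L(1) by (rule has_derivative_subset) (use \<phi>_in in blast)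
        then have "(F has_derivative L \<circ> (\<lambda>v. \<chi> i. v * w $ i)) (at \<zeta> within ball 0 1)"
          using diff_chain_within[OF \<phi>'] by (simp add: F_def o_def)
        \<comment> \<open>Complex linearity of \<open>L\<close> makes the real derivative of
          \<open>F\<close> multiplication by the complex number \<open>L w\<close>.\<close>
        moreover have "L \<circ> (\<lambda>v. \<chi> i. v * w $ i) = (*) (L w)"
          using L(2)[rule_format, of _ w] by (simp add: fun_eq_iff vector_scalar_mult_def mult.commute)
        ultimately show "F field_differentiable at \<zeta> within ball 0 1"
          unfolding field_differentiable_def has_field_derivative_def by auto
      qed
      moreover have "Re (F \<zeta>) \<ge> 0" if \<zeta>: "\<zeta> \<in> ball 0 1" for \<zeta>
      proof -
        obtain x where "x \<in> U \<inter> X" "\<phi> \<zeta> = h x" using \<phi>_in[OF \<zeta>] by blast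
        then show ?thesis using u(2) inj by (simp add: F_def)
      qed
      ultimately show ?thesis
        using Harnack_disc[of F "1/2"] by (simp add: F_def \<phi>0 \<phi>q)
    qed
    then show ?thesis by (simp add: Harnack_constant_def)
  qed
  ultimately show ?thesis using that by blast
qed

text \<open>The points having a constant form a set that is open and closed in \<open>X\<close>.
  Openness extends a chain from \<open>x\<close> to a neighbour \<open>y\<close>; closedness extends
  one from \<open>y\<close> back to \<open>x\<close>. Hence both directions of the local inequality
  are used.\<close>

lemma Harnack_connected:
  fixes \<A> :: "('a, 'n::finite) chart set"
  assumes man: "complex_manifold T \<A>" and X: "openin T X" "connectedin T X"
    and p: "p \<in> X" and q: "q \<in> X"
  shows "\<exists>C\<ge>0. Harnack_constant \<A> X p q C"
proof -
  define S where "S = {q \<in> X. \<exists>C\<ge>0. Harnack_constant \<A> X p q C}"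
  have "\<exists>N. openin T N \<and> x \<in> N \<and> N \<subseteq> S" if x: "x \<in> S" for x
  proof -
    have "x \<in> X" using x by (simp add: S_def)
    from Harnack_local[OF man X(1) this] obtain N where N: "openin T N" "x \<in> N" "N \<subseteq> X"
      "\<And>q. q \<in> N \<Longrightarrow> Harnack_constant \<A> X x q 3 \<and> Harnack_constant \<A> X q x 3" by metis
    obtain C where "C \<ge> 0" "Harnack_constant \<A> X p x C" using x by (auto simp: S_def)
    have "Harnack_constant \<A> X p y (C * 3)" if "y \<in> N" for y
      using N(4)[OF that] \<open>C \<ge> 0\<close> \<open>Harnack_constant \<A> X p x C\<close>
      by (blast intro: Harnack_constant_trans)
    then have "N \<subseteq> S"
      using N(3) \<open>C \<ge> 0\<close> by (auto simp: S_def intro!: exI[of _ "C * 3"])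
    with N show ?thesis by blast
  qed
  then have "openin T S" using openin_subopen by metis
  moreover have "\<exists>N. openin T N \<and> x \<in> N \<and> N \<subseteq> X - S" if x: "x \<in> X - S" for x
  proof -
    have "x \<in> X" using x by simp
    from Harnack_local[OF man X(1) this] obtain N where N: "openin T N" "x \<in> N" "N \<subseteq> X"
      "\<And>q. q \<in> N \<Longrightarrow> Harnack_constant \<A> X x q 3 \<and> Harnack_constant \<A> X q x 3" by metis
    have "y \<notin> S" if "y \<in> N" for y
    proof
      assume "y \<in> S"
      then obtain C where "C \<ge> 0" "Harnack_constant \<A> X p y C" by (auto simp: S_def)
      then have "Harnack_constant \<A> X p x (C * 3)"
        using N(4)[OF that] by (auto intro: Harnack_constant_trans)
      with \<open>x \<in> X\<close> \<open>C \<ge> 0\<close> have "x \<in> S"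
        by (auto simp: S_def intro!: exI[of _ "C * 3"])
      with x show False by blast
    qed
    with N show ?thesis by blast
  qed
  then have "openin T (X - S)" using openin_subopen by metis
  moreover have "p \<in> S"
    using p by (auto simp: S_def Harnack_constant_def intro!: exI[of _ 1])
  ultimately have "X - S = {}"
    using connectedinD[OF X(2), of S "X - S"] p by blast
  then show ?thesis using q by (auto simp: S_def)
qed

text \<open>Each point of \<open>K\<close> has a neighbourhood with a single constant; the maximum
  over a finite subcover serves all of \<open>K\<close>.\<close>

lemma Harnack_compact:
  fixes \<A> :: "('a, 'n::finite) chart set"
  assumes man: "complex_manifold T \<A>" and X: "openin T X" "connectedin T X"
    and p: "p \<in> X" and K: "compactin T K" "K \<subseteq> X"
  obtains C where "C \<ge> 1" "\<And>q. q \<in> K \<Longrightarrow> Harnack_constant \<A> X p q C"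
proof -
  have "\<exists>N C. openin T N \<and> x \<in> N \<and> (\<forall>q\<in>N. Harnack_constant \<A> X p q C)" if "x \<in> K" for x
  proof -
    have x: "x \<in> X" using that K by blast
    from Harnack_local[OF man X(1) x] obtain N where N: "openin T N" "x \<in> N" "N \<subseteq> X"
      "\<And>q. q \<in> N \<Longrightarrow> Harnack_constant \<A> X x q 3 \<and> Harnack_constant \<A> X q x 3" by metis
    obtain C where "C \<ge> 0" "Harnack_constant \<A> X p x C"
      using Harnack_connected[OF man X p x] by blast
    then have "\<forall>q\<in>N. Harnack_constant \<A> X p q (C * 3)"
      using N(4) by (auto intro: Harnack_constant_trans)
    with N(1,2) show ?thesis by blast
  qed
  then obtain N C where N: "\<And>x. x \<in> K \<Longrightarrow> openin T (N x) \<and> x \<in> N x"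
    and C: "\<And>x q. x \<in> K \<Longrightarrow> q \<in> N x \<Longrightarrow> Harnack_constant \<A> X p q (C x)"
    by metis
  have "\<And>U. U \<in> N ` K \<Longrightarrow> openin T U" "K \<subseteq> \<Union>(N ` K)" using N by auto
  with K(1) obtain \<F> where "finite \<F>" "\<F> \<subseteq> N ` K" "K \<subseteq> \<Union>\<F>"
    by (meson compactinD)
  then obtain I where I: "finite I" "I \<subseteq> K" "K \<subseteq> \<Union>(N ` I)"
    by (metis finite_subset_image)
  \<comment> \<open>Inserting 1 keeps the maximum defined when \<open>I\<close> is empty and ensures
    \<open>D \<ge> 1\<close>, so that \<open>1 - 1 / D\<close> later lies in
    \<open>[0, 1)\<close>.\<close>
  define D where "D = Max (insert 1 (C ` I))"
  have "D \<ge> 1" using I by (simp add: D_def)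
  moreover have "Harnack_constant \<A> X p q D" if q: "q \<in> K" for q
  proof -
    obtain x where x: "x \<in> I" "q \<in> N x" using q I by blast
    then have "Harnack_constant \<A> X p q (C x)" using C I by blast
    moreover have "C x \<le> D" using x I by (simp add: D_def)
    \<comment> \<open>Since \<open>q\<close> lies in \<open>X\<close>, \<open>Re (u q)\<close> is
      nonnegative, so enlarging the constant preserves the inequality.\<close>
    moreover have "q \<in> X" using q K by blast
    ultimately show ?thesis
      unfolding Harnack_constant_def by (meson mult_right_mono order_trans)
  qed
  ultimately show ?thesis using that by blast
qed

text \<open>Harnack for \<open>M - u\<close> and \<open>u - m\<close>, compared with the value at a
  base point \<open>p\<close>, keeps \<open>Re u\<close> on \<open>K\<close> away from
  \<open>M\<close> and \<open>m\<close> by fixed fractions of \<open>M - Re (u p)\<close> and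
  \<open>Re (u p) - m\<close>. These two distances add up to \<open>M - m\<close>.\<close>

lemma oscillation_contraction:
  fixes \<A> :: "('a, 'n::finite) chart set"
  assumes man: "complex_manifold T \<A>" and X: "openin T X" "connectedin T X" "X \<noteq> {}"
    and K: "compactin T K" "K \<subseteq> X"
  obtains c where "0 \<le> c" "c < 1"
    "\<And>u m M. holomorphic_function_on \<A> X u \<Longrightarrow> \<forall>x\<in>X. m \<le> Re (u x) \<and> Re (u x) \<le> M \<Longrightarrow>
       \<exists>m' M'. M' - m' = c * (M - m) \<and> (\<forall>x\<in>K. m' \<le> Re (u x) \<and> Re (u x) \<le> M')"
proof -
  obtain p where p: "p \<in> X" using X by blast
  obtain C where C: "C \<ge> 1" "\<And>q. q \<in> K \<Longrightarrow> Harnack_constant \<A> X p q C"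
    using Harnack_compact[OF man X(1,2) p K] by metis
  define c where "c = 1 - 1 / C"
  have "\<exists>m' M'. M' - m' = c * (M - m) \<and> (\<forall>x\<in>K. m' \<le> Re (u x) \<and> Re (u x) \<le> M')"
    if u: "holomorphic_function_on \<A> X u" and bd: "\<forall>x\<in>X. m \<le> Re (u x) \<and> Re (u x) \<le> M" for u m M
  proof (intro exI conjI ballI)
    let ?t = "Re (u p)"
    \<comment> \<open>Unification with this line fixes the witnesses:
      \<open>M' = M - (M - ?t) / C\<close> and \<open>m' = m + (?t - m) / C\<close>.\<close>
    show "(M - (M - ?t) / C) - (m + (?t - m) / C) = c * (M - m)"
      using C(1) by (simp add: c_def field_simps)
    fix x assume x: "x \<in> K"
    have "holomorphic_function_on \<A> X (\<lambda>x. of_real M + (- 1) * u x)"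
         "holomorphic_function_on \<A> X (\<lambda>x. of_real (- m) + 1 * u x)"
      by (intro holomorphic_function_on_affine u)+
    then have "M - ?t \<le> C * (M - Re (u x))" "?t - m \<le> C * (Re (u x) - m)"
      using C(2)[OF x] bd unfolding Harnack_constant_def by fastforce+
    then show "m + (?t - m) / C \<le> Re (u x)" "Re (u x) \<le> M - (M - ?t) / C"
      using C(1) by (simp_all add: field_simps)
  qed
  moreover have "0 \<le> c" "c < 1" using C(1) by (auto simp: c_def field_simps)
  ultimately show ?thesis using that by blast
qed

section \<open>Nested compact sets and convergence to a constant\<close>

text \<open>Otherwise the sets \<open>C n - U\<close> would be nested nonempty closed subsets of the
  compact \<open>C 0\<close> with empty intersection. With \<open>U\<close> empty this shows that
  the intersection of nonempty \<open>C n\<close> is nonempty; with \<open>U\<close> a neighbourhood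
  of the fixed point it gives convergence.\<close>

lemma compactin_nested_subset_open:
  fixes C :: "nat \<Rightarrow> 'a set"
  assumes "Hausdorff_space X" "\<And>n. compactin X (C n)" "decseq C"
    and "openin X U" "(\<Inter>n. C n) \<subseteq> U"
  shows "\<exists>n. C n \<subseteq> U"
proof (rule ccontr)
  assume *: "\<nexists>n. C n \<subseteq> U"
  let ?Y = "subtopology X (C 0)"
  have C0: "C n \<subseteq> C 0" for n using assms(3) by (simp add: decseq_def)
  have "closedin ?Y (C n - U)" for n
  proof -
    have "closedin X (C n)" using assms compactin_imp_closedin by blast
    then have "closedin X (C n - U)" using assms(4) by (rule closedin_diff)
    then show ?thesis using C0[of n] by (auto intro!: closedin_subset_topspace)
  qed
  moreover have "compact_space ?Y" using assms(2) by (simp add: compact_space_subtopology)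
  moreover have "C n - U \<noteq> {}" for n using * by blast
  moreover have "decseq (\<lambda>n. C n - U)" using assms(3) by (auto simp: decseq_def)
  ultimately have "(\<Inter>n. C n - U) \<noteq> {}" by (intro compact_space_imp_nest) auto
  then show False using assms(5) by blast
qed

lemma limitin_compact_open_const:
  assumes cont: "\<And>n. continuous_map X Y (g n)" and c: "c \<in> topspace Y"
    and conv: "\<And>U. openin Y U \<Longrightarrow> c \<in> U \<Longrightarrow> \<forall>\<^sub>F n in sequentially. g n ` topspace X \<subseteq> U"
  shows "limitin (compact_open_topology X Y) g (\<lambda>_. c) sequentially"
proof -
  let ?S = "{{g. continuous_map X Y g \<and> g ` K \<subseteq> U} | K U. compactin X K \<and> openin Y U}"
  have "{g. continuous_map X Y g \<and> g ` {} \<subseteq> topspace Y} \<in> ?S"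
    using compactin_empty openin_topspace by blast
  moreover have "(\<lambda>_. c) \<in> {g. continuous_map X Y g \<and> g ` {} \<subseteq> topspace Y}"
    using c by simp
  ultimately have top: "(\<lambda>_. c) \<in> topspace (compact_open_topology X Y)"
    unfolding compact_open_topology_def topology_generated_by_topspace by (rule UnionI)
  \<comment> \<open>Induction over the generated topology: eventual membership passes to finite
    intersections and arbitrary unions, so only subbasic sets need work.\<close>
  have ev: "(\<lambda>_. c) \<in> W \<longrightarrow> (\<forall>\<^sub>F n in sequentially. g n \<in> W)" if "generate_topology_on ?S W" for W
    using that
  proof induction
    case (Basis W)
    then obtain K U where W: "W = {g. continuous_map X Y g \<and> g ` K \<subseteq> U}" and K: "compactin X K" and U: "openin Y U"
      by blast
    show ?case
    proof
      assume "(\<lambda>_. c) \<in> W"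
      \<comment> \<open>For empty \<open>K\<close> the subbasic set consists of all continuous maps,
        even if \<open>c\<close> is outside \<open>U\<close>.\<close>
      then have "K = {} \<or> c \<in> U" by (auto simp: W)
      then show "\<forall>\<^sub>F n in sequentially. g n \<in> W"
      proof
        assume "c \<in> U"
        from conv[OF U this] show ?thesis
          by (rule eventually_mono) (use K compactin_subset_topspace cont in \<open>fastforce simp: W\<close>)
      qed (simp add: W cont)
    qed
  next
    case (UN \<K>)
    show ?case
    proof
      assume "(\<lambda>_. c) \<in> \<Union>\<K>"
      then obtain k where "k \<in> \<K>" "(\<lambda>_. c) \<in> k" by blast
      with UN.IH have "\<forall>\<^sub>F n in sequentially. g n \<in> k" by blast
      then show "\<forall>\<^sub>F n in sequentially. g n \<in> \<Union>\<K>"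
        by (rule eventually_mono) (use \<open>k \<in> \<K>\<close> in blast)
    qed
  qed (auto intro: eventually_conj)
  then show ?thesis
    using top by (auto simp: limitin_def compact_open_topology_def openin_topology_generated_by_iff)
qed

section \<open>The fixed point\<close>

theorem theorem4:
  fixes A :: "'a topology" and \<A> :: "('a, 'n::finite) chart set"
    and X :: "'a set" and f :: "'a \<Rightarrow> 'a"
  assumes "stein_manifold A \<A>"
    and "hyperbolic_domain A \<A> X"
    and "holomorphic_map A \<A> X X f"
    and "relatively_compact_in (subtopology A X) (f ` X)"
  shows "\<exists>c\<in>X. f c = c \<and> (\<forall>z\<in>X. f z = z \<longrightarrow> z = c) \<and>
    limitin (compact_open_topology (subtopology A X) (subtopology A X))
      (\<lambda>n. f ^^ n) (\<lambda>z. c) sequentially"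
proof -
  let ?X = "subtopology A X"
  have man: "complex_manifold A \<A>" using assms(1) by (simp add: stein_manifold_def)
  have X: "openin A X" "connectedin A X" "X \<noteq> {}"
    using assms(2) by (auto simp: hyperbolic_domain_def domain_in_def)
  have tX: "topspace ?X = X"
    using openin_subset X by (intro topspace_subtopology_subset) blast
  have "Hausdorff_space A" using man by (simp add: complex_manifold_def)
  then have haus: "Hausdorff_space ?X" by (rule Hausdorff_space_subtopology)
  have cf: "continuous_map ?X ?X f" using assms(3) by (simp add: holomorphic_map_def)
  have cfn: "continuous_map ?X ?X (f ^^ n)" for n
    by (induction n) (auto simp: id_def intro: continuous_map_compose[OF _ cf, unfolded o_def] simp: o_def)
  define K where "K = ?X closure_of (f ` X)"
  have Kc: "compactin ?X K" and fX: "f ` X \<subseteq> X"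
    using assms(4) by (auto simp: relatively_compact_in_def K_def tX)
  have KX: "K \<subseteq> X" using compactin_subset_topspace[OF Kc] by (simp add: tX)
  have KA: "compactin A K" using Kc by (simp add: compactin_subtopology)
  have fK: "f ` X \<subseteq> K" unfolding K_def using fX by (intro closure_of_subset) (simp only: tX)
  define C where "C n = (f ^^ n) ` K" for n
  have Cc: "compactin ?X (C n)" for n
    unfolding C_def using Kc cfn by (rule image_compactin)
  have CX: "C n \<subseteq> X" for n using compactin_subset_topspace[OF Cc] by (simp add: tX)
  have "C (Suc n) \<subseteq> C n" for n
  proof -
    have "C (Suc n) = (f ^^ n) ` f ` K" by (simp add: C_def funpow_swap1 image_image)
    also have "\<dots> \<subseteq> C n" unfolding C_def using KX fK by blast
    finally show ?thesis .
  qed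
  then have Cdec: "decseq C" by (simp add: decseq_Suc_iff)
  \<comment> \<open>The index is shifted by one because one application of \<open>f\<close> is spent
    on bringing \<open>X\<close> into \<open>K\<close>.\<close>
  have XC: "(f ^^ Suc n) ` X \<subseteq> C n" for n
    unfolding C_def using fK by (auto simp: funpow_swap1)
  define L where "L = (\<Inter>n. C n)"
  obtain c where c: "0 \<le> c" "c < 1"
    "\<And>u m M. holomorphic_function_on \<A> X u \<Longrightarrow> \<forall>x\<in>X. m \<le> Re (u x) \<and> Re (u x) \<le> M \<Longrightarrow>
       \<exists>m' M'. M' - m' = c * (M - m) \<and> (\<forall>x\<in>K. m' \<le> Re (u x) \<and> Re (u x) \<le> M')"
    by (rule oscillation_contraction[OF man X KA KX]) blast
  \<comment> \<open>The factor \<open>b\<close> lets an estimate for real parts cover imaginary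
    parts too: take \<open>b = 1\<close> and \<open>b = \<i>\<close>.\<close>
  have const: "Re (b * g x) = Re (b * g y)"
    if g: "holomorphic_function A \<A> g" and xy: "x \<in> L" "y \<in> L" for b g x y
  proof -
    \<comment> \<open>Starting with one application of \<open>f\<close> makes \<open>u 0\<close>
      bounded on \<open>X\<close>: \<open>g\<close> is bounded on the compact \<open>K\<close>, but
      possibly not on \<open>X\<close>.\<close>
    define u where "u n z = b * g ((f ^^ Suc n) z)" for n z
    have hol: "holomorphic_function_on \<A> X (u n)" for n
    proof (induction n)
      case 0
      have "holomorphic_function_on \<A> X (\<lambda>z. 0 + b * g z)"
        using holomorphic_function_imp_on[OF g] by (rule holomorphic_function_on_affine)
      then show ?case
        using holomorphic_function_on_compose[OF man X(1) assms(3)] by (simp add: u_def)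
    next
      case (Suc n)
      from holomorphic_function_on_compose[OF man X(1) assms(3) Suc] show ?case
        by (simp add: u_def funpow_swap1)
    qed
    have "compact (g ` K)"
      using image_compactin[OF KA, of euclidean g] g by (simp add: holomorphic_function_def)
    then obtain B where B: "\<And>z. z \<in> K \<Longrightarrow> cmod (g z) \<le> B"
      by (meson bounded_iff compact_imp_bounded imageI)
    have osc: "\<exists>m M. M - m = c ^ n * (2 * (cmod b * B)) \<and> (\<forall>z\<in>X. m \<le> Re (u n z) \<and> Re (u n z) \<le> M)" for n
    proof (induction n)
      case 0
      have "\<bar>Re (u 0 z)\<bar> \<le> cmod b * B" if "z \<in> X" for z
      proof -
        have "cmod (g (f z)) \<le> B" using B fK that by blast
        then have "cmod (b * g (f z)) \<le> cmod b * B"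
          by (simp add: norm_mult mult_left_mono)
        then show ?thesis using abs_Re_le_cmod[of "b * g (f z)"] by (simp add: u_def)
      qed
      then have "\<forall>z\<in>X. - (cmod b * B) \<le> Re (u 0 z) \<and> Re (u 0 z) \<le> cmod b * B"
        by (meson abs_le_D1 abs_le_D2 minus_le_iff)
      moreover have "cmod b * B - (- (cmod b * B)) = c ^ 0 * (2 * (cmod b * B))"
        by simp
      ultimately show ?case by blast
    next
      case (Suc n)
      then obtain m M where mM: "M - m = c ^ n * (2 * (cmod b * B))"
        "\<forall>z\<in>X. m \<le> Re (u n z) \<and> Re (u n z) \<le> M" by blast
      obtain m' M' where "M' - m' = c * (M - m)" "\<forall>z\<in>K. m' \<le> Re (u n z) \<and> Re (u n z) \<le> M'"
        using c(3)[OF hol mM(2)] by blast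
      \<comment> \<open>As \<open>f\<close> sends \<open>X\<close> into \<open>K\<close>, the
        contracted bounds for \<open>u n\<close> on \<open>K\<close> become bounds for
        \<open>u (Suc n)\<close> on all of \<open>X\<close>.\<close>
      moreover have "u (Suc n) z = u n (f z)" for z by (simp add: u_def funpow_swap1)
      ultimately have "M' - m' = c ^ Suc n * (2 * (cmod b * B)) \<and>
          (\<forall>z\<in>X. m' \<le> Re (u (Suc n) z) \<and> Re (u (Suc n) z) \<le> M')"
        using fK mM(1) by auto
      then show ?case by blast
    qed
    \<comment> \<open>Points of \<open>L\<close> are images of points of \<open>X\<close> under
      every iterate, so values of \<open>b * g\<close> on \<open>L\<close> are values of each
      \<open>u n\<close> on \<open>X\<close> and inherit its oscillation bound.\<close>
    have preimage: "\<exists>x'\<in>X. (f ^^ Suc n) x' = z" if "z \<in> L" for n z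
    proof -
      have "z \<in> C (Suc n)" using that by (simp add: L_def)
      then show ?thesis using KX unfolding C_def by blast
    qed
    have bd: "\<bar>Re (b * g x) - Re (b * g y)\<bar> \<le> c ^ n * (2 * (cmod b * B))" for n
    proof -
      obtain x' y' where x'y': "x' \<in> X" "y' \<in> X" "x = (f ^^ Suc n) x'" "y = (f ^^ Suc n) y'"
        using preimage[OF xy(1)] preimage[OF xy(2)] by metis
      obtain m M where "M - m = c ^ n * (2 * (cmod b * B))"
        "\<forall>z\<in>X. m \<le> Re (u n z) \<and> Re (u n z) \<le> M"
        using osc by blast
      moreover have "Re (b * g x) = Re (u n x')" "Re (b * g y) = Re (u n y')"
        unfolding u_def x'y' by (rule refl)+
      ultimately show ?thesis using x'y'(1,2) by (smt (verit, best))
    qed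
    have "(\<lambda>n. c ^ n * (2 * (cmod b * B))) \<longlonglongrightarrow> 0 * (2 * (cmod b * B))"
      using c by (intro tendsto_intros LIMSEQ_power_zero) simp
    then have "\<bar>Re (b * g x) - Re (b * g y)\<bar> \<le> 0"
      using bd by (intro LIMSEQ_le_const[where X = "\<lambda>n. c ^ n * (2 * (cmod b * B))"]) auto
    then show ?thesis by simp
  qed
  have LX: "L \<subseteq> X" using CX[of 0] unfolding L_def by blast
  have single: "x = y" if "x \<in> L" "y \<in> L" for x y
  proof (rule ccontr)
    assume "x \<noteq> y"
    moreover have "x \<in> topspace A" "y \<in> topspace A"
      using that LX openin_subset[OF X(1)] by blast+
    ultimately obtain g where g: "holomorphic_function A \<A> g" "g x \<noteq> g y"
      using assms(1) unfolding stein_manifold_def by blast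
    have "Re (g x) = Re (g y)" "Im (g x) = Im (g y)"
      using const[OF g(1) that, of 1] const[OF g(1) that, of "\<i>"] by auto
    with g(2) show False by (simp add: complex_eq_iff)
  qed
  have "K \<noteq> {}" using fK X(3) by blast
  then have "\<nexists>n. C n \<subseteq> {}" by (simp add: C_def)
  then have "L \<noteq> {}"
    using compactin_nested_subset_open[OF haus Cc Cdec openin_empty] unfolding L_def by blast
  then obtain p where p: "p \<in> L" by blast
  have L: "L = {p}" using p single by blast
  have pX: "p \<in> X" using p LX by blast
  \<comment> \<open>A fixed point lies in the image of every iterate, hence in every
    \<open>C n\<close>; uniqueness follows from \<open>L = {p}\<close>.\<close>
  have fixL: "z \<in> L" if "z \<in> X" "f z = z" for z
  proof -
    have "(f ^^ n) z = z" for n by (induction n) (use that in auto)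
    then show ?thesis
      using XC that(1) unfolding L_def by (metis (no_types, lifting) INT_I image_subset_iff)
  qed
  \<comment> \<open>Applying \<open>f\<close> moves \<open>C n\<close> to \<open>C (Suc n)\<close>,
    so \<open>f p\<close> stays in the intersection, whose only point is \<open>p\<close>.\<close>
  have "f p \<in> C n" for n
  proof -
    have "p \<in> C n" using p by (simp add: L_def)
    then have "f p \<in> C (Suc n)" by (auto simp: C_def)
    then show ?thesis using \<open>C (Suc n) \<subseteq> C n\<close> by blast
  qed
  then have "f p = p" using L by (auto simp: L_def)
  moreover have "limitin (compact_open_topology ?X ?X) (\<lambda>n. f ^^ n) (\<lambda>z. p) sequentially"
  proof (rule limitin_compact_open_const[OF cfn])
    show "p \<in> topspace ?X" using pX by (simp only: tX)
    fix U assume "openin ?X U" "p \<in> U"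
    then obtain N where N: "C N \<subseteq> U"
      using compactin_nested_subset_open[OF haus Cc Cdec, of U] L by (auto simp: L_def)
    have "(f ^^ n) ` topspace ?X \<subseteq> U" if n: "n > N" for n
    proof -
      obtain m where m: "n = Suc m" "m \<ge> N"
        using less_imp_Suc_add[OF n] by auto
      then have "C m \<subseteq> C N" using Cdec by (simp add: decseq_def)
      with XC[of m] N m show ?thesis unfolding tX by blast
    qed
    then show "\<forall>\<^sub>F n in sequentially. (f ^^ n) ` topspace ?X \<subseteq> U"
      by (rule eventually_mono[OF eventually_gt_at_top[of N]])
  qed
  ultimately show ?thesis using pX fixL L by blast
qed

end
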